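(* Let $m\geq 5$ and $h\geq 1$ be integers, let $n=m^h$, and let $\overline{\Gamma_{m^h}}$ be the complement of the multiplicative circulant graph $\Gamma_{m^h}=C_{m^h}(1,m,m^2,\ldots,m^{h-1})$. Then for every vertex $v\in\{0,1,\ldots,n-1\}$, $$d_{\overline{\Gamma_{m^h}}}(0,v)=\begin{cases}0 & \text{if } v=0,\\ 2 & \text{if } v\in\{1,m,m^2,\ldots,m^{h-1}\}\cup\{n-1,n-m,n-m^2,\ldots,n-m^{h-1}\},\\ 1 & \text{otherwise.}\end{cases}$$
   Context: For $S\subseteq\mathbb{Z}_n\setminus\{0\}$, the circulant graph $C_n(S)$ is the simple undirected graph with vertex set $\mathbb{Z}_n=\{0,1,\ldots,n-1\}$ and edge set $\{\{g,g+s\}: g\in\mathbb{Z}_n, s\in S\}$ (addition mod $n$); $C_n(s_1,\ldots,s_t)$ means $C_n(\{s_1,\ldots,s_t\})$. $\overline{\Gamma}$ denotes the complement of the graph $\Gamma$, and $d_{\Gamma}(u,v)$ is the length of a shortest path between $u$ and $v$ in $\Gamma$. *)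

theory Defs
  imports "Graph_Theory.Pair_Digraph" "Graph_Theory.Shortest_Path"
begin

text \<open>
  Simple undirected graphs are represented as in the Graph Theory entry, namely as finite,
  symmetric, loop-free sets of arcs (locale \<^locale>\<open>pair_graph\<close>): the undirected edge
  joining \<open>u\<close> and \<open>v\<close> is the pair of arcs \<open>(u, v)\<close>, \<open>(v, u)\<close>.
\<close>

text \<open>
  The residues mod \<open>n\<close> are the natural numbers below \<open>n\<close>. The connection set is meant to
  satisfy \<open>S \<subseteq> {1..<n}\<close>, and only then is the result a simple graph.
\<close>

definition circulant_graph :: "nat \<Rightarrow> nat set \<Rightarrow> nat pair_pre_digraph" where
  "circulant_graph n S =
    \<lparr> pverts = {..<n},
      parcs = {(u, v). \<exists>g\<in>{..<n}. \<exists>s\<in>S. {u, v} = {g, (g + s) mod n}} \<rparr>"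

definition graph_complement :: "'a pair_pre_digraph \<Rightarrow> 'a pair_pre_digraph" where
  "graph_complement G =
    \<lparr> pverts = pverts G,
      parcs = {(u, v). u \<in> pverts G \<and> v \<in> pverts G \<and> u \<noteq> v \<and> (u, v) \<notin> parcs G} \<rparr>"

definition multiplicative_circulant :: "nat \<Rightarrow> nat \<Rightarrow> nat pair_pre_digraph" where
  "multiplicative_circulant m h = circulant_graph (m ^ h) {m ^ i | i. i < h}"

text \<open>
  The distance is the library's shortest-path cost with every arc costing 1. It is
  \<open>\<infinity>\<close> when no path exists; see \<open>graph_dist_shortest_path\<close> below for the other case.
\<close>

definition graph_dist :: "'a pair_pre_digraph \<Rightarrow> 'a \<Rightarrow> 'a \<Rightarrow> ereal" where
  "graph_dist G u v = wf_digraph.\<mu> (with_proj G) (\<lambda>_. 1) u v"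

lemma pair_graph_circulant_graph:
  assumes "S \<subseteq> {1..<n}"
  shows "pair_graph (circulant_graph n S)"
proof -
  let ?G = "circulant_graph n S"
  have sub: "parcs ?G \<subseteq> {..<n} \<times> {..<n}"
    by (auto simp: circulant_graph_def doubleton_eq_iff)
  have no_loop: "(g + s) mod n \<noteq> g" if "g < n" "s \<in> S" for g s
  proof
    assume "(g + s) mod n = g"
    moreover have "s \<ge> 1" "s < n"
      using that assms by auto
    ultimately show False
      using that by (cases "g + s < n") (auto simp: mod_if split: if_splits)
  qed
  show ?thesis
  proof
    show "finite (pverts ?G)"
      by (simp add: circulant_graph_def)
    show "finite (parcs ?G)"
      using sub by (rule finite_subset) simp
    show "symmetric (with_proj ?G)"
      by (auto simp: symmetric_def sym_def circulant_graph_def insert_commute)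
  next
    fix e assume e: "e \<in> parcs ?G"
    then show "fst e \<in> pverts ?G" "snd e \<in> pverts ?G"
      using sub by (auto simp: circulant_graph_def doubleton_eq_iff)
    show "fst e \<noteq> snd e"
      using e no_loop by (auto simp: circulant_graph_def doubleton_eq_iff) (metis no_loop)+
  qed
qed

lemma pair_graph_graph_complement:
  assumes "pair_graph G"
  shows "pair_graph (graph_complement G)"
proof -
  interpret G: pair_graph G by fact
  let ?H = "graph_complement G"
  have sub: "parcs ?H \<subseteq> pverts G \<times> pverts G"
    by (auto simp: graph_complement_def)
  show ?thesis
  proof
    show "finite (pverts ?H)"
      by (simp add: graph_complement_def G.pair_finite_verts)
    show "finite (parcs ?H)"
      using sub by (rule finite_subset) (simp add: G.pair_finite_verts)
    show "symmetric (with_proj ?H)"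
      using G.pair_sym_arcs by (auto simp: symmetric_def sym_def graph_complement_def)
  qed (auto simp: graph_complement_def)
qed

lemma pair_graph_multiplicative_circulant:
  assumes "m \<ge> 2"
  shows "pair_graph (multiplicative_circulant m h)"
  unfolding multiplicative_circulant_def
  by (rule pair_graph_circulant_graph) (use assms in \<open>auto simp: power_strict_increasing\<close>)

lemma graph_dist_shortest_path:
  assumes "pair_graph G" and "pre_digraph.apath (with_proj G) u q v"
  obtains p where "pre_digraph.apath (with_proj G) u p v"
    and "graph_dist G u v = ereal (real (length p))"
    and "\<And>p'. pre_digraph.apath (with_proj G) u p' v \<Longrightarrow> length p \<le> length p'"
proof -
  interpret G: pair_graph G by fact
  have cost: "G.awalk_cost (\<lambda>_. 1) p = real (length p)" for p
    by (induction p) auto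
  have reach: "u \<rightarrow>\<^sup>*\<^bsub>with_proj G\<^esub> v"
    using assms(2) G.awalkI_apath G.reachable_awalk by blast
  obtain p where p: "G.apath u p v" "G.\<mu> (\<lambda>_. 1) u v = G.awalk_cost (\<lambda>_. 1) p"
    using G.no_neg_cyc_reach_imp_path[OF reach, of "\<lambda>_. 1"] by (auto simp: cost)
  have "length p \<le> length p'" if "G.apath u p' v" for p'
    using G.min_cost_le_walk_cost[OF G.awalkI_apath[OF that], of "\<lambda>_. 1"]
    by (simp add: p(2) cost)
  with p show ?thesis
    by (intro that[of p]) (auto simp: graph_dist_def cost)
qed

end

theory Submission
  imports Defs "HOL-Number_Theory.Cong"
begin

text \<open>
  The circulant graph joins \<open>a\<close> and \<open>b\<close> exactly when \<open>b - a\<close> is congruent to \<open>m ^ i\<close> or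
  \<open>- m ^ i\<close> for some \<open>i < h\<close>. In its complement, therefore, the vertex \<open>0\<close> is adjacent to
  every nonzero vertex outside the list of residues \<open>m ^ i\<close> and \<open>- m ^ i\<close>, and a residue on
  the list is at distance at least 2. What remains is to give each of these a common
  neighbour with \<open>0\<close>.

  For \<open>v = m ^ i\<close> the vertex \<open>w = 3 * m ^ i\<close> works, because the differences \<open>w - 0\<close> and
  \<open>v - w\<close> are \<open>3 * m ^ i\<close> and \<open>- 2 * m ^ i\<close>; for \<open>v = - m ^ i\<close> the vertex
  \<open>- 3 * m ^ i\<close> works in the same way. The reason is that a multiple \<open>d * m ^ i\<close> with
  \<open>2 \<le> \<bar>d\<bar> \<le> m - 2\<close> is never congruent modulo \<open>m ^ h\<close> to a signed power of \<open>m\<close> below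
  \<open>m ^ h\<close>, as one sees by comparing divisibility by powers of \<open>m\<close>
  (lemma \<open>small_multiple_not_cong_signed_power\<close>). The bound \<open>m \<ge> 5\<close> says precisely that
  \<open>d = 3\<close> is in this range.
\<close>

section \<open>Distances up to two\<close>

context pair_graph
begin

lemma graph_dist_path_bound:
  assumes "apath u q v"
  obtains p where "apath u p v" and "graph_dist G u v = ereal (real (length p))"
    and "length p \<le> length q"
  using graph_dist_shortest_path[OF pair_graph_axioms assms] assms by blast

lemma graph_dist_self:
  assumes "u \<in> pverts G"
  shows "graph_dist G u u = 0"
proof -
  have "apath u [] u"
    using assms by (simp add: apath_Nil_iff)
  then show ?thesis
    by (rule graph_dist_path_bound) simp
qed

lemma graph_dist_adjacent:
  assumes "(u, v) \<in> parcs G"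
  shows "graph_dist G u v = 1"
proof -
  have "u \<noteq> v"
    using assms no_loops by fastforce
  have "apath u [(u, v)] v"
    using assms \<open>u \<noteq> v\<close> in_arcsD1[OF assms] in_arcsD2[OF assms]
    by (auto simp: apath_Cons_iff apath_Nil_iff)
  then obtain p where p: "apath u p v" "graph_dist G u v = ereal (real (length p))"
    and "length p \<le> length [(u, v)]"
    by (rule graph_dist_path_bound)
  moreover have "p \<noteq> []"
    using p(1) \<open>u \<noteq> v\<close> by (auto simp: apath_Nil_iff)
  ultimately have "length p = 1"
    by (cases p) auto
  then show ?thesis
    using p(2) by (simp add: one_ereal_def)
qed

lemma graph_dist_common_neighbour:
  assumes "u \<noteq> v" and "(u, v) \<notin> parcs G" and "(u, w) \<in> parcs G" and "(w, v) \<in> parcs G"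
  shows "graph_dist G u v = 2"
proof -
  have "u \<noteq> w" "w \<noteq> v"
    using assms no_loops by fastforce+
  have "apath u [(u, w), (w, v)] v"
    using assms \<open>u \<noteq> w\<close> \<open>w \<noteq> v\<close>
    by (auto intro: in_arcsD1 in_arcsD2 simp: apath_Cons_iff apath_Nil_iff)
  then obtain p where p: "apath u p v" "graph_dist G u v = ereal (real (length p))"
    and "length p \<le> length [(u, w), (w, v)]"
    by (rule graph_dist_path_bound)
  moreover have "length p \<noteq> 0"
    using p(1) \<open>u \<noteq> v\<close> by (auto simp: apath_Nil_iff)
  moreover have "length p \<noteq> 1"
    using p(1) assms(2) by (auto simp: length_Suc_conv apath_Cons_iff apath_Nil_iff)
  ultimately have "length p = 2"
    by (simp only: list.size)
  then show ?thesis
    using p(2) by simp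
qed

end

section \<open>Adjacency in circulant graphs\<close>

lemma circulant_graph_arc_iff:
  assumes "a < n" and "b < n"
  shows "(a, b) \<in> parcs (circulant_graph n S) \<longleftrightarrow>
    (\<exists>s\<in>S. b = (a + s) mod n \<or> a = (b + s) mod n)"
  using assms by (auto simp: circulant_graph_def doubleton_eq_iff)

lemma circulant_graph_zero_arc_iff:
  assumes "S \<subseteq> {..<n}" and "0 < v" and "v < n"
  shows "(0, v) \<in> parcs (circulant_graph n S) \<longleftrightarrow> v \<in> S \<union> (\<lambda>s. n - s) ` S"
proof -
  have "v = s mod n \<longleftrightarrow> v = s" "0 = (v + s) mod n \<longleftrightarrow> v = n - s" if "s \<in> S" for s
  proof -
    have "s < n"
      using that assms(1) by auto
    then show "v = s mod n \<longleftrightarrow> v = s"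
      by simp
    show "0 = (v + s) mod n \<longleftrightarrow> v = n - s"
      using \<open>s < n\<close> assms(2,3) by (cases "v + s < n") (auto simp: mod_if)
  qed
  then show ?thesis
    using assms by (auto simp: circulant_graph_arc_iff)
qed

section \<open>Small multiples of powers\<close>

lemma power_not_dvd_small_multiple:
  fixes m d :: int
  assumes "0 < m" and "d \<noteq> 0" and "\<bar>d\<bar> < m" and "i < k"
  shows "\<not> m ^ k dvd d * m ^ i"
proof
  assume "m ^ k dvd d * m ^ i"
  moreover have "m ^ Suc i dvd m ^ k"
    using \<open>i < k\<close> by (intro le_imp_power_dvd) simp
  ultimately have "m * m ^ i dvd d * m ^ i"
    by (metis dvd_trans power_Suc)
  then have "m dvd d"
    using \<open>0 < m\<close> by simp
  then show False
    using assms zdvd_not_zless[of "\<bar>d\<bar>" m] by simp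
qed

text \<open>
  Congruent numbers modulo \<open>m ^ h\<close> are divisible by the same powers \<open>m ^ k\<close> with \<open>k \<le> h\<close>. If
  the exponents differ, the term with the smaller one has coefficient \<open>d\<close> or \<open>e\<close>, which \<open>m\<close>
  does not divide, so the higher power of \<open>m\<close> divides one side but not the other. If the
  exponents agree, the coefficient of the difference is \<open>d - e\<close>, which is nonzero and smaller
  than \<open>m\<close> in absolute value.
\<close>

lemma small_multiple_not_cong_signed_power:
  fixes m d e :: int
  assumes "2 \<le> \<bar>d\<bar>" and "\<bar>d\<bar> \<le> m - 2" and "\<bar>e\<bar> = 1" and "i < h" and "j < h"
  shows "\<not> [d * m ^ i = e * m ^ j] (mod m ^ h)"
proof
  assume "[d * m ^ i = e * m ^ j] (mod m ^ h)"
  then have *: "m ^ h dvd d * m ^ i - e * m ^ j"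
    by (simp add: cong_iff_dvd_diff)
  have **: "m ^ k dvd d * m ^ i \<longleftrightarrow> m ^ k dvd e * m ^ j" if "k \<le> h" for k
    using dvd_trans[OF le_imp_power_dvd[OF that] *] dvd_diff_right_iff
    by (meson cong_dvd_iff cong_iff_dvd_diff)
  have "m > 0"
    using assms by linarith
  consider "i = j" | "i < j" | "j < i"
    by linarith
  then show False
  proof cases
    case 1
    then have "m ^ h dvd (d - e) * m ^ i"
      using * by (simp add: left_diff_distrib)
    moreover have "d - e \<noteq> 0" "\<bar>d - e\<bar> < m"
      using assms by linarith+
    ultimately show False
      using power_not_dvd_small_multiple \<open>m > 0\<close> \<open>i < h\<close> by blast
  next
    case 2
    then have "m ^ j dvd d * m ^ i"
      using **[of j] \<open>j < h\<close> by simp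
    moreover have "d \<noteq> 0" "\<bar>d\<bar> < m"
      using assms by linarith+
    ultimately show False
      using power_not_dvd_small_multiple \<open>m > 0\<close> 2 by blast
  next
    case 3
    then have "m ^ i dvd e * m ^ j"
      using **[of i] \<open>i < h\<close> by simp
    moreover have "e \<noteq> 0" "\<bar>e\<bar> < m"
      using assms by linarith+
    ultimately show False
      using power_not_dvd_small_multiple \<open>m > 0\<close> 3 by blast
  qed
qed

section \<open>Distances in the complement\<close>

text \<open>
  This supplies both arcs of each path of length 2 in the complement. The multiplier \<open>d\<close> is
  signed so that the paths to \<open>m ^ i\<close> and to \<open>- m ^ i\<close> are covered alike.
\<close>

lemma complement_arc_small_multiple:
  fixes m h a b i :: nat and d :: int
  assumes "a < m ^ h" and "b < m ^ h" and "i < h"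
    and d: "2 \<le> \<bar>d\<bar>" "\<bar>d\<bar> \<le> int m - 2"
    and diff: "[int b - int a = d * int m ^ i] (mod int m ^ h)"
  shows "(a, b) \<in> parcs (graph_complement (multiplicative_circulant m h))"
proof -
  have "a \<noteq> b"
  proof
    assume "a = b"
    then have "int m ^ h dvd d * int m ^ i"
      using diff by (simp add: cong_iff_dvd_diff)
    moreover have "0 < int m" "d \<noteq> 0" "\<bar>d\<bar> < int m"
      using d by linarith+
    ultimately show False
      using power_not_dvd_small_multiple \<open>i < h\<close> by blast
  qed
  have no_signed_power: False
    if "[int b - int a = e * int m ^ j] (mod int m ^ h)" "\<bar>e\<bar> = 1" "j < h" for e j
    using small_multiple_not_cong_signed_power[OF d that(2) \<open>i < h\<close> that(3)]
      cong_trans[OF cong_sym[OF diff] that(1)] by blast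
  have "(a, b) \<notin> parcs (multiplicative_circulant m h)"
  proof
    assume "(a, b) \<in> parcs (multiplicative_circulant m h)"
    then obtain j where j: "j < h"
      and arc: "b = (a + m ^ j) mod m ^ h \<or> a = (b + m ^ j) mod m ^ h"
      using assms(1,2)
      by (auto simp: multiplicative_circulant_def circulant_graph_arc_iff)
    from arc show False
    proof
      assume "b = (a + m ^ j) mod m ^ h"
      then have "int b = (int a + int m ^ j) mod int m ^ h"
        by (metis of_nat_add of_nat_mod of_nat_power)
      then have "[int b - int a = 1 * int m ^ j] (mod int m ^ h)"
        by (simp add: cong_def mod_diff_left_eq)
      then show False
        using no_signed_power[of 1 j] j by simp
    next
      assume "a = (b + m ^ j) mod m ^ h"
      then have "int a = (int b + int m ^ j) mod int m ^ h"
        by (metis of_nat_add of_nat_mod of_nat_power)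
      then have "[int b - int a = (- 1) * int m ^ j] (mod int m ^ h)"
        by (simp add: cong_def mod_diff_right_eq)
      then show False
        using no_signed_power[of "- 1" j] j by simp
    qed
  qed
  with \<open>a \<noteq> b\<close> assms(1,2) show ?thesis
    by (simp add: graph_complement_def multiplicative_circulant_def circulant_graph_def)
qed

theorem theorem3p3:
  fixes m h n v :: nat
  assumes "m \<ge> 5" and "h \<ge> 1" and "n = m ^ h" and "v \<in> {0..n - 1}"
  shows "graph_dist (graph_complement (multiplicative_circulant m h)) 0 v =
    (if v = 0 then 0
     else if v \<in> {m ^ i | i. i < h} \<union> {n - m ^ i | i. i < h} then 2
     else 1)"
proof -
  let ?G = "multiplicative_circulant m h"
  let ?H = "graph_complement ?G"
  let ?S = "{m ^ i | i. i < h}"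
  interpret H: pair_graph ?H
    using assms(1) by (intro pair_graph_graph_complement pair_graph_multiplicative_circulant) simp
  have "n > 0"
    using assms by simp
  with assms(4) have "v < n"
    by auto
  have verts: "pverts ?H = {..<n}"
    by (simp add: assms(3) graph_complement_def multiplicative_circulant_def circulant_graph_def)
  have minus: "(\<lambda>s. n - s) ` ?S = {n - m ^ i | i. i < h}"
    by auto
  have "?S \<subseteq> {..<n}"
    using assms(1,3) by (auto intro: power_strict_increasing)
  then have arc_iff: "(0, v) \<in> parcs ?H \<longleftrightarrow> v \<notin> ?S \<union> {n - m ^ i | i. i < h}" if "v \<noteq> 0"
    using circulant_graph_zero_arc_iff[of ?S n v] that \<open>v < n\<close> \<open>n > 0\<close> verts
    unfolding minus
    by (simp add: graph_complement_def multiplicative_circulant_def assms(3))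
  consider "v = 0" | "v \<noteq> 0" "v \<notin> ?S \<union> {n - m ^ i | i. i < h}"
    | "v \<noteq> 0" "v \<in> ?S \<union> {n - m ^ i | i. i < h}"
    by blast
  then show ?thesis
  proof cases
    case 1
    then show ?thesis
      using H.graph_dist_self[of 0] verts \<open>n > 0\<close> by simp
  next
    case 2
    then have "graph_dist ?H 0 v = 1"
      using arc_iff by (intro H.graph_dist_adjacent) blast
    with 2 show ?thesis
      by simp
  next
    case 3
    then obtain i where i: "i < h" and v: "v = m ^ i \<or> v = n - m ^ i"
      by blast
    have "3 * m ^ i < m * m ^ i"
      using assms(1) by simp
    also have "\<dots> = m ^ Suc i"
      by simp
    also have "\<dots> \<le> n"
      unfolding assms(3) using i assms(1) by (intro power_increasing) auto
    finally have less: "3 * m ^ i < n" .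
    have "m ^ i > 0"
      using assms(1) by simp
    have "\<exists>w. (0, w) \<in> parcs ?H \<and> (w, v) \<in> parcs ?H"
      using v
    proof
      assume v: "v = m ^ i"
      have "(0, 3 * m ^ i) \<in> parcs ?H"
        using less \<open>n > 0\<close> assms(1,3) i
        by (intro complement_arc_small_multiple[where i = i and d = 3]) auto
      moreover have "(3 * m ^ i, v) \<in> parcs ?H"
        using less \<open>v < n\<close> assms(1,3) i
        by (intro complement_arc_small_multiple[where i = i and d = "- 2"]) (auto simp: v)
      ultimately show ?thesis
        by blast
    next
      assume v: "v = n - m ^ i"
      have "[int (n - 3 * m ^ i) - int 0 = - 3 * int m ^ i] (mod int m ^ h)"
        using less by (simp add: of_nat_diff assms(3) cong_iff_dvd_diff)
      then have "(0, n - 3 * m ^ i) \<in> parcs ?H"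
        using \<open>n > 0\<close> \<open>m ^ i > 0\<close> assms(1,3) i
        by (intro complement_arc_small_multiple[where i = i and d = "- 3"]) auto
      moreover have "int v - int (n - 3 * m ^ i) = 2 * int m ^ i"
        using less by (simp add: v of_nat_diff)
      then have "(n - 3 * m ^ i, v) \<in> parcs ?H"
        using \<open>v < n\<close> \<open>m ^ i > 0\<close> \<open>n > 0\<close> assms(1,3) i
        by (intro complement_arc_small_multiple[where i = i and d = 2]) auto
      ultimately show ?thesis
        by blast
    qed
    then have "graph_dist ?H 0 v = 2"
      using 3 arc_iff by (elim exE conjE) (rule H.graph_dist_common_neighbour, auto)
    with 3 show ?thesis
      by simp
  qed
qed

end
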